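(* Let $\eta>1$, $0<\beta\le 1$, and let $\{x^t\}_{t=0}^\infty$ be a sequence generated by the proximal diagonal Newton method (PDNM) without termination. Suppose that $f$ is $m$-strongly convex (with respect to the $\ell_2$ norm, $m>0$), $\nabla f$ is Lipschitz continuous with constant $L_1$, and $g$ is convex. Let $x^*$ be the unique minimizer of $F=f+g$. Then $$\frac{m}{2}\|x^t-x^*\|_2^2\le F(x^t)-F(x^* )\le\left(1-\frac{\sigma}{\overline{\eta}\tau}\right)^t\bigl(F(x^0)-F(x^* )\bigr)$$ for all $t\ge0$, where $\overline{\eta}=\max\{\frac{1}{\tau},\frac{\eta}{\beta}\}\ge1$.
   Context: Problem: minimize $F(x):=f(x)+g(x)$ over $x\in\mathbb{R}^n$, where $f:\mathbb{R}^n\to\mathbb{R}$ is twice continuously differentiable, $g:\mathbb{R}^n\to(-\infty,\infty]$ is proper, closed (lower semicontinuous) and directionally differentiable (for all $x\in\operatorname{dom}g$ and all $d$ with $x+\epsilon d\in\operatorname{dom} g$ for all sufficiently small $\epsilon>0$, the limit $g'(x;d)=\lim_{\epsilon\searrow0}(g(x+\epsilon d)-g(x))/\epsilon$ exists in $[-\infty,\infty]$), and $F$ is bounded below. Notation: for a square matrix $A$, $\operatorname{diag}(A)$ is the diagonal matrix with the same diagonal entries as $A$. For a positive definite matrix $A$, $\|x\|_A=\sqrt{x^\top Ax}$ and $\operatorname{prox}_g^A(x)=\operatorname{argmin}_y\{g(y)+\frac12\|y-x\|_A^2\}$ (a set). Constants (when $\operatorname{diag}(\nabla^2 f(x))$ is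 positive definite for all $x$): $$\sigma=\inf_{x,\,v\ne0,\,0\le\lambda\le1}\frac{v^\top\nabla^2f(x+\lambda v)v}{v^\top\operatorname{diag}(\nabla^2f(x))v},\qquad \tau=\sup_{x,\,v\ne0,\,0\le\lambda\le1}\frac{v^\top\nabla^2f(x+\lambda v)v}{v^\top\operatorname{diag}(\nabla^2f(x))v},$$ with $x,v$ ranging over $\mathbb{R}^n$. PDNM with parameters $\eta>1$, $\beta>0$ and starting point $x^0\in\operatorname{dom}g$: at iteration $t=0,1,2,\dots$ put $D_t=\operatorname{diag}(\nabla^2f(x^t))$ (positive definite). For $k=0,1,2,\dots$ successively compute a trial point $x^{t,k}\in\operatorname{prox}_g^{\eta^kD_t}\bigl(x^t-(\eta^kD_t)^{-1}\nabla f(x^t)\bigr)$, and let $k_t$ be the first $k$ for which $$f(x^{t,k})\le f(x^t)+\nabla f(x^t)^\top(x^{t,k}-x^t)+\frac{\beta}{2}\|x^{t,k}-x^t\|_{\eta^kD_t}^2.$$ Set $x^{t+1}=x^{t,k_t}$. *)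

theory Defs
  imports "HOL-Analysis.Analysis"
begin

definition grad :: "(real ^ 'n \<Rightarrow> real) \<Rightarrow> real ^ 'n \<Rightarrow> real ^ 'n" where
  "grad f x = (THE D. GDERIV f x :> D)"

definition hessian :: "(real ^ 'n \<Rightarrow> real) \<Rightarrow> real ^ 'n \<Rightarrow> real ^ 'n ^ 'n" where
  "hessian f x = jacobian (grad f) (at x)"

definition twice_continuously_differentiable :: "(real ^ 'n \<Rightarrow> real) \<Rightarrow> bool" where
  "twice_continuously_differentiable f \<longleftrightarrow>
     (\<forall>x. f differentiable (at x)) \<and> (\<forall>x. grad f differentiable (at x)) \<and>
     continuous_on UNIV (hessian f)"

definition strongly_convex :: "real \<Rightarrow> (real ^ 'n \<Rightarrow> real) \<Rightarrow> bool" where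
  "strongly_convex m f \<longleftrightarrow>
     (\<forall>x y. \<forall>u\<in>{0..1}. f ((1 - u) *\<^sub>R x + u *\<^sub>R y)
        \<le> (1 - u) * f x + u * f y - m / 2 * (1 - u) * u * (norm (x - y))\<^sup>2)"

definition edom :: "('a \<Rightarrow> ereal) \<Rightarrow> 'a set" where
  "edom g = {x. g x < \<infinity>}"

definition proper :: "('a \<Rightarrow> ereal) \<Rightarrow> bool" where
  "proper g \<longleftrightarrow> (\<forall>x. g x \<noteq> -\<infinity>) \<and> edom g \<noteq> {}"

definition lower_semicontinuous :: "('a :: topological_space \<Rightarrow> ereal) \<Rightarrow> bool" where
  "lower_semicontinuous g \<longleftrightarrow> (\<forall>x. g x \<le> Liminf (at x) g)"

text \<open>The inequality below is meaningful only for functions omitting the value \<open>-\<infinity>\<close>,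
  so that the right-hand side never has the form \<open>\<infinity> - \<infinity>\<close>.\<close>

definition econvex :: "(real ^ 'n \<Rightarrow> ereal) \<Rightarrow> bool" where
  "econvex g \<longleftrightarrow>
     (\<forall>x y. \<forall>u\<in>{0<..<1}. g ((1 - u) *\<^sub>R x + u *\<^sub>R y) \<le> ereal (1 - u) * g x + ereal u * g y)"

text \<open>The limit is taken in \<open>ereal\<close>, so the values \<open>\<infinity>\<close> and \<open>-\<infinity>\<close> are admitted.\<close>

definition directionally_differentiable :: "(real ^ 'n \<Rightarrow> ereal) \<Rightarrow> bool" where
  "directionally_differentiable g \<longleftrightarrow>
     (\<forall>x\<in>edom g. \<forall>d. (\<forall>\<^sub>F \<epsilon> in at_right 0. x + \<epsilon> *\<^sub>R d \<in> edom g) \<longrightarrow>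
        (\<exists>l. ((\<lambda>\<epsilon>. (g (x + \<epsilon> *\<^sub>R d) - g x) / ereal \<epsilon>) \<longlongrightarrow> l) (at_right 0)))"

definition objective :: "(real ^ 'n \<Rightarrow> real) \<Rightarrow> (real ^ 'n \<Rightarrow> ereal) \<Rightarrow> real ^ 'n \<Rightarrow> ereal" where
  "objective f g x = ereal (f x) + g x"

definition diag :: "real ^ 'n ^ 'n \<Rightarrow> real ^ 'n ^ 'n" where
  "diag A = (\<chi> i j. if i = j then A $ i $ i else 0)"

definition positive_definite :: "real ^ 'n ^ 'n \<Rightarrow> bool" where
  "positive_definite A \<longleftrightarrow> transpose A = A \<and> (\<forall>v. v \<noteq> 0 \<longrightarrow> v \<bullet> (A *v v) > 0)"

definition norm_mat :: "real ^ 'n ^ 'n \<Rightarrow> real ^ 'n \<Rightarrow> real" where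
  "norm_mat A x = sqrt (x \<bullet> (A *v x))"

definition prox :: "(real ^ 'n \<Rightarrow> ereal) \<Rightarrow> real ^ 'n ^ 'n \<Rightarrow> real ^ 'n \<Rightarrow> (real ^ 'n) set" where
  "prox g A x = {z. is_arg_min (\<lambda>y. g y + ereal (1 / 2 * (norm_mat A (y - x))\<^sup>2)) (\<lambda>_. True) z}"

definition curvature_ratios :: "(real ^ 'n \<Rightarrow> real) \<Rightarrow> real set" where
  "curvature_ratios f =
     {(v \<bullet> (hessian f (x + u *\<^sub>R v) *v v)) / (v \<bullet> (diag (hessian f x) *v v)) | x v u.
        v \<noteq> 0 \<and> 0 \<le> u \<and> u \<le> 1}"

text \<open>Infimum and supremum are taken in \<open>real\<close>, hence unspecified if the set of ratios is
  unbounded. If \<open>f\<close> is \<open>m\<close>-strongly convex with \<open>L\<close>-Lipschitz gradient, all ratios lie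
  between \<open>m / L\<close> and \<open>L / m\<close>.\<close>

definition sigma_const :: "(real ^ 'n \<Rightarrow> real) \<Rightarrow> real" where
  "sigma_const f = Inf (curvature_ratios f)"

definition tau_const :: "(real ^ 'n \<Rightarrow> real) \<Rightarrow> real" where
  "tau_const f = Sup (curvature_ratios f)"

definition sufficient_decrease ::
  "(real ^ 'n \<Rightarrow> real) \<Rightarrow> real \<Rightarrow> real ^ 'n ^ 'n \<Rightarrow> real ^ 'n \<Rightarrow> real ^ 'n \<Rightarrow> bool" where
  "sufficient_decrease f \<beta> A x y \<longleftrightarrow>
     f y \<le> f x + grad f x \<bullet> (y - x) + \<beta> / 2 * (norm_mat A (y - x))\<^sup>2"

text \<open>One iteration, from \<open>x\<close> to \<open>x'\<close>: \<open>y j\<close> is the trial point for the \<open>j\<close>-th scaling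
  (only \<open>j \<le> k\<close> matters) and \<open>k\<close> is the first index whose trial point is accepted.
  The proximal map may be multivalued, so this is a relation.\<close>

definition pdnm_step ::
  "(real ^ 'n \<Rightarrow> real) \<Rightarrow> (real ^ 'n \<Rightarrow> ereal) \<Rightarrow> real \<Rightarrow> real \<Rightarrow> real ^ 'n \<Rightarrow> real ^ 'n \<Rightarrow> bool"
where
  "pdnm_step f g \<eta> \<beta> x x' \<longleftrightarrow>
     (let D = diag (hessian f x) in
        positive_definite D \<and>
        (\<exists>(y :: nat \<Rightarrow> real ^ 'n) k.
           (\<forall>j\<le>k. y j \<in> prox g (\<eta> ^ j *\<^sub>R D) (x - matrix_inv (\<eta> ^ j *\<^sub>R D) *v grad f x)) \<and>
           (\<forall>j<k. \<not> sufficient_decrease f \<beta> (\<eta> ^ j *\<^sub>R D) x (y j)) \<and>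
           sufficient_decrease f \<beta> (\<eta> ^ k *\<^sub>R D) x (y k) \<and>
           x' = y k))"

definition pdnm_sequence ::
  "(real ^ 'n \<Rightarrow> real) \<Rightarrow> (real ^ 'n \<Rightarrow> ereal) \<Rightarrow> real \<Rightarrow> real \<Rightarrow> (nat \<Rightarrow> real ^ 'n) \<Rightarrow> bool" where
  "pdnm_sequence f g \<eta> \<beta> x \<longleftrightarrow>
     x 0 \<in> edom g \<and> (\<forall>t. pdnm_step f g \<eta> \<beta> (x t) (x (Suc t)))"

end

theory Submission
  imports Defs
begin

text \<open>A rejected trial point shows, by Taylor's formula, that its scaling is below
  \<open>\<tau> / \<beta>\<close>, so the accepted scaling is at most \<open>M = max 1 (\<eta> \<tau> / \<beta>)\<close>, the product of the two
  constants in the rate. Sufficient decrease (with \<open>\<beta> \<le> 1\<close>) and the optimality of the proximal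
  point then bound the new objective value by the quadratic model with curvature \<open>M D\<close> at
  every competitor. The competitor \<open>x + \<alpha> (x\<^sup>* - x)\<close> with \<open>\<alpha> = \<sigma> / M\<close> makes the quadratic term
  cancel against the lower curvature bound \<open>f x\<^sup>* \<ge> f x + \<nabla>f x \<bullet> (x\<^sup>* - x) + \<sigma>/2 |x\<^sup>* - x|\<^sub>D\<^sup>2\<close>, which
  leaves a contraction by \<open>1 - \<alpha>\<close>. Minimizing sequences of a strongly convex function bounded
  below are Cauchy, so lower semicontinuity provides the minimizer.\<close>

section \<open>Gradient, Hessian and Taylor's formula along a line\<close>

lemma GDERIV_grad:
  assumes "f differentiable (at x)"
  shows "GDERIV f x :> grad f x"
proof -
  obtain f' where f': "(f has_derivative f') (at x)"
    using assms by (auto simp: differentiable_def)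
  \<comment> \<open>Riesz representation: a real-valued linear map is the inner product with its
    adjoint at 1.\<close>
  have "f' = (\<lambda>h. h \<bullet> adjoint f' 1)"
    using adjoint_works[OF has_derivative_linear[OF f'], of _ 1] by auto
  then have "GDERIV f x :> adjoint f' 1"
    using f' by (metis gderiv_def)
  \<comment> \<open>Since \<open>grad\<close> is a definite description, a derivative is identified
    with it only once uniqueness is known.\<close>
  moreover have "D = E" if "GDERIV f x :> D" "GDERIV f x :> E" for D E
  proof -
    have "(\<lambda>h. h \<bullet> D) = (\<lambda>h. h \<bullet> E)"
      using that has_derivative_unique unfolding gderiv_def by blast
    then have "h \<bullet> (D - E) = 0" for h
      by (simp add: inner_diff_right fun_eq_iff)
    from this[of "D - E"] show ?thesis by simp
  qed
  ultimately show ?thesis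
    unfolding grad_def by (metis (mono_tags, lifting) theI)
qed

lemma DERIV_along_line:
  assumes "f differentiable (at (x + t *\<^sub>R v))"
  shows "((\<lambda>t. f (x + t *\<^sub>R v)) has_real_derivative grad f (x + t *\<^sub>R v) \<bullet> v) (at t)"
proof -
  have "((\<lambda>t. x + t *\<^sub>R v) has_derivative (\<lambda>h. h *\<^sub>R v)) (at t)"
    by (auto intro!: derivative_eq_intros)
  from has_derivative_compose[OF this GDERIV_grad[OF assms, unfolded gderiv_def]]
  show ?thesis
    unfolding has_field_derivative_def
    by (rule has_derivative_eq_rhs) (simp add: fun_eq_iff inner_commute mult.commute)
qed

lemma DERIV_grad_along_line:
  assumes "grad f differentiable (at (x + t *\<^sub>R v))"
  shows "((\<lambda>t. grad f (x + t *\<^sub>R v) \<bullet> w) has_real_derivative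
           w \<bullet> (hessian f (x + t *\<^sub>R v) *v v)) (at t)"
proof -
  have "((\<lambda>t. x + t *\<^sub>R v) has_derivative (\<lambda>h. h *\<^sub>R v)) (at t)"
    by (auto intro!: derivative_eq_intros)
  from has_derivative_compose[OF this assms[unfolded jacobian_works]]
  have "((\<lambda>t. grad f (x + t *\<^sub>R v)) has_derivative
          (\<lambda>h. h *\<^sub>R (hessian f (x + t *\<^sub>R v) *v v))) (at t)"
    by (simp add: hessian_def matrix_vector_mult_scaleR)
  from has_derivative_inner_left[OF this, of w]
  show ?thesis
    unfolding has_field_derivative_def
    by (rule has_derivative_eq_rhs) (simp add: fun_eq_iff inner_commute mult.commute)
qed

text \<open>One-variable Taylor with Lagrange remainder for \<open>f\<close> restricted to the
  segment from \<open>x\<close> to \<open>x + v\<close>. The intermediate point lies on that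
  segment, exactly where \<open>curvature_ratios\<close> evaluates the Hessian.\<close>

lemma taylor_hessian:
  assumes "twice_continuously_differentiable f"
  obtains u where "0 < u" "u < 1"
    "f (x + v) = f x + grad f x \<bullet> v + (v \<bullet> (hessian f (x + u *\<^sub>R v) *v v)) / 2"
proof -
  define diff where "diff k = (if k = 0 then \<lambda>t. f (x + t *\<^sub>R v)
      else if k = Suc 0 then \<lambda>t. grad f (x + t *\<^sub>R v) \<bullet> v
      else (\<lambda>t. v \<bullet> (hessian f (x + t *\<^sub>R v) *v v)))" for k :: nat
  have "\<forall>k t. k < 2 \<and> 0 \<le> t \<and> t \<le> 1 \<longrightarrow> DERIV (diff k) t :> diff (Suc k) t"
    using assms DERIV_along_line[of f x _ v] DERIV_grad_along_line[of f x _ v v]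
    by (auto simp: twice_continuously_differentiable_def diff_def less_2_cases_iff)
  from Taylor_up[of 2 diff "diff 0", OF _ _ this, of 0] obtain t where
    "0 < t" "t < 1" "diff 0 1 = (\<Sum>k<2. diff k 0 / fact k) + diff 2 t / 2"
    by auto
  then show ?thesis
    by (intro that[of t]) (auto simp: diff_def numeral_2_eq_2)
qed

section \<open>Hessian bounds from strong convexity and the Lipschitz gradient\<close>

text \<open>Dividing the convexity inequality by \<open>u\<close> leaves a difference quotient on
  the left; \<open>u\<close> then tends to 0 from the right.\<close>

lemma strongly_convex_first_order:
  assumes "strongly_convex m f" "f differentiable (at x)"
  shows "f x + grad f x \<bullet> (y - x) + m / 2 * (norm (y - x))\<^sup>2 \<le> f y"
proof -
  have lim: "((\<lambda>u. (f (x + u *\<^sub>R (y - x)) - f x) / u) \<longlongrightarrow> grad f x \<bullet> (y - x)) (at_right 0)"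
    using DERIV_along_line[of f x 0 "y - x"] assms(2)
    by (auto simp: has_field_derivative_iff intro: filterlim_mono at_le)
  have lim': "((\<lambda>u. f y - f x - m / 2 * (1 - u) * (norm (y - x))\<^sup>2) \<longlongrightarrow>
      f y - f x - m / 2 * (1 - 0) * (norm (y - x))\<^sup>2) (at_right 0)"
    by (intro tendsto_intros)
  have "\<forall>\<^sub>F u in at_right 0. (f (x + u *\<^sub>R (y - x)) - f x) / u
      \<le> f y - f x - m / 2 * (1 - u) * (norm (y - x))\<^sup>2"
  proof (rule eventually_at_rightI[of 0 1])
    fix u :: real assume u: "u \<in> {0<..<1}"
    have "f ((1 - u) *\<^sub>R x + u *\<^sub>R y)
        \<le> (1 - u) * f x + u * f y - m / 2 * (1 - u) * u * (norm (x - y))\<^sup>2"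
      using assms(1) u unfolding strongly_convex_def by (meson atLeastAtMost_iff greaterThanLessThan_iff less_imp_le)
    moreover have "(1 - u) *\<^sub>R x + u *\<^sub>R y = x + u *\<^sub>R (y - x)"
      by (simp add: algebra_simps)
    ultimately show "(f (x + u *\<^sub>R (y - x)) - f x) / u
        \<le> f y - f x - m / 2 * (1 - u) * (norm (y - x))\<^sup>2"
      using u by (simp add: field_simps norm_minus_commute)
  qed auto
  from tendsto_le[OF _ lim' lim this] show ?thesis
    by (simp add: trivial_limit_at_right_real)
qed

text \<open>Adding the first-order inequalities at the two end points makes the gradient strongly
  monotone; the Hessian form is the limit of the resulting difference quotients.\<close>

lemma hessian_ge_strongly_convex:
  assumes "strongly_convex m f" "twice_continuously_differentiable f"
  shows "m * (norm v)\<^sup>2 \<le> v \<bullet> (hessian f x *v v)"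
proof -
  have diff: "f differentiable (at z)" "grad f differentiable (at z)" for z
    using assms(2) by (auto simp: twice_continuously_differentiable_def)
  have "((\<lambda>t. (grad f (x + t *\<^sub>R v) \<bullet> v - grad f x \<bullet> v) / t) \<longlongrightarrow>
      v \<bullet> (hessian f x *v v)) (at_right 0)"
    using DERIV_grad_along_line[of f x 0 v v] diff
    by (auto simp: has_field_derivative_iff intro: filterlim_mono at_le)
  moreover have "m * (norm v)\<^sup>2 \<le> (grad f (x + t *\<^sub>R v) \<bullet> v - grad f x \<bullet> v) / t"
    if "t > 0" for t
  proof -
    have "m * (norm (t *\<^sub>R v))\<^sup>2 \<le> grad f (x + t *\<^sub>R v) \<bullet> (t *\<^sub>R v) - grad f x \<bullet> (t *\<^sub>R v)"
      using strongly_convex_first_order[OF assms(1) diff(1), of x "x + t *\<^sub>R v"]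
        strongly_convex_first_order[OF assms(1) diff(1), of "x + t *\<^sub>R v" x]
      by simp
    then have "t * (t * (m * (norm v)\<^sup>2)) \<le> t * (grad f (x + t *\<^sub>R v) \<bullet> v - grad f x \<bullet> v)"
      by (simp add: algebra_simps power2_eq_square)
    then have "t * (m * (norm v)\<^sup>2) \<le> grad f (x + t *\<^sub>R v) \<bullet> v - grad f x \<bullet> v"
      using that mult_le_cancel_left_pos by blast
    then show ?thesis
      using that by (simp add: field_simps)
  qed
  then have "\<forall>\<^sub>F t in at_right 0. m * (norm v)\<^sup>2
      \<le> (grad f (x + t *\<^sub>R v) \<bullet> v - grad f x \<bullet> v) / t"
    by (intro eventually_at_rightI[of 0 1]) auto
  ultimately show ?thesis
    by (intro tendsto_lowerbound) auto
qed

text \<open>Cauchy-Schwarz and the Lipschitz constant bound the same difference quotients from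
  above.\<close>

lemma hessian_le_lipschitz:
  assumes "L-lipschitz_on UNIV (grad f)" "twice_continuously_differentiable f"
  shows "v \<bullet> (hessian f x *v v) \<le> L * (norm v)\<^sup>2"
proof -
  have diff: "grad f differentiable (at z)" for z
    using assms(2) by (auto simp: twice_continuously_differentiable_def)
  have "((\<lambda>t. (grad f (x + t *\<^sub>R v) \<bullet> v - grad f x \<bullet> v) / t) \<longlongrightarrow>
      v \<bullet> (hessian f x *v v)) (at_right 0)"
    using DERIV_grad_along_line[of f x 0 v v] diff
    by (auto simp: has_field_derivative_iff intro: filterlim_mono at_le)
  moreover have "(grad f (x + t *\<^sub>R v) \<bullet> v - grad f x \<bullet> v) / t \<le> L * (norm v)\<^sup>2"
    if "t > 0" for t
  proof -
    have "(grad f (x + t *\<^sub>R v) - grad f x) \<bullet> v \<le> norm (grad f (x + t *\<^sub>R v) - grad f x) * norm v"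
      by (rule norm_cauchy_schwarz)
    also have "\<dots> \<le> L * norm (t *\<^sub>R v) * norm v"
      using lipschitz_onD[OF assms(1), of "x + t *\<^sub>R v" x]
      by (intro mult_right_mono) (auto simp: dist_norm)
    finally show ?thesis
      using that by (simp add: inner_diff_left field_simps power2_eq_square)
  qed
  then have "\<forall>\<^sub>F t in at_right 0. (grad f (x + t *\<^sub>R v) \<bullet> v - grad f x \<bullet> v) / t \<le> L * (norm v)\<^sup>2"
    by (intro eventually_at_rightI[of 0 1]) auto
  ultimately show ?thesis
    by (intro tendsto_upperbound) auto
qed

section \<open>The curvature constants sigma and tau\<close>

lemma inner_diag_mult: "v \<bullet> (diag A *v v) = (\<Sum>i\<in>UNIV. A $ i $ i * (v $ i)\<^sup>2)"
proof -
  have "(diag A *v v) $ i = A $ i $ i * v $ i" for i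
    by (simp add: diag_def matrix_vector_mult_def if_distrib[of "\<lambda>a. a * _"] cong: if_cong)
  then show ?thesis
    by (simp add: inner_vec_def power2_eq_square mult_ac)
qed

lemma inner_axis_mult_axis: "axis i 1 \<bullet> (A *v axis i 1) = (A :: real ^ 'n ^ 'n) $ i $ i"
  by (simp add: matrix_vector_mult_basis inner_axis' column_def)

context
  fixes f :: "real ^ 'n \<Rightarrow> real" and m L :: real
  assumes C2: "twice_continuously_differentiable f"
    and sc: "strongly_convex m f" and m: "m > 0"
    and lip: "L-lipschitz_on UNIV (grad f)"
begin

text \<open>Diagonal entries are values of the Hessian form at unit axis vectors, so they lie in
  \<open>[m, L]\<close>; the diagonal form is the sum of squares with these weights.\<close>

lemma hessian_diag_bounds:
  "m * (norm v)\<^sup>2 \<le> v \<bullet> (diag (hessian f x) *v v)"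
  "v \<bullet> (diag (hessian f x) *v v) \<le> L * (norm v)\<^sup>2"
proof -
  have "m \<le> hessian f x $ i $ i" "hessian f x $ i $ i \<le> L" for i
    using hessian_ge_strongly_convex[OF sc C2, of "axis i 1" x]
      hessian_le_lipschitz[OF lip C2, of "axis i 1" x]
    by (simp_all add: inner_axis_mult_axis)
  moreover have "(norm v)\<^sup>2 = (\<Sum>i\<in>UNIV. (v $ i)\<^sup>2)"
    by (simp add: norm_vec_def L2_set_def sum_nonneg)
  ultimately show
    "m * (norm v)\<^sup>2 \<le> v \<bullet> (diag (hessian f x) *v v)"
    "v \<bullet> (diag (hessian f x) *v v) \<le> L * (norm v)\<^sup>2"
    by (auto simp: inner_diag_mult sum_distrib_left intro!: sum_mono mult_right_mono)
qed

lemma inner_hessian_diag_pos: "v \<noteq> 0 \<Longrightarrow> 0 < v \<bullet> (diag (hessian f x) *v v)"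
  using hessian_diag_bounds(1)[of v x] m
  by (meson less_le_trans mult_pos_pos zero_less_norm_iff zero_less_power)

text \<open>Numerator and denominator both lie between \<open>m\<close> and \<open>L\<close> times
  the squared norm of \<open>v\<close>. Comparing these bounds at a nonzero \<open>v\<close> also
  yields \<open>L > 0\<close>.\<close>

lemma curvature_ratios_bounds:
  assumes "r \<in> curvature_ratios f"
  shows "m / L \<le> r" "r \<le> L / m" "L > 0"
proof -
  obtain x v u where v: "v \<noteq> 0" and
    r: "r = (v \<bullet> (hessian f (x + u *\<^sub>R v) *v v)) / (v \<bullet> (diag (hessian f x) *v v))"
    using assms by (auto simp: curvature_ratios_def)
  let ?N = "(norm v)\<^sup>2"
  let ?d = "v \<bullet> (diag (hessian f x) *v v)"
  have N: "?N > 0" using v by simp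
  note d = hessian_diag_bounds[of v x] inner_hessian_diag_pos[OF v, of x]
  have "0 < L * ?N" using d by linarith
  with N show L: "L > 0" by (simp add: zero_less_mult_iff)
  have "m / L * ?d \<le> m / L * (L * ?N)"
    using d m L by (intro mult_left_mono) auto
  also have "\<dots> = m * ?N" using L by simp
  also have "\<dots> \<le> v \<bullet> (hessian f (x + u *\<^sub>R v) *v v)"
    by (rule hessian_ge_strongly_convex[OF sc C2])
  finally show "m / L \<le> r" using d by (simp add: r field_simps)
  have "v \<bullet> (hessian f (x + u *\<^sub>R v) *v v) \<le> L * ?N"
    by (rule hessian_le_lipschitz[OF lip C2])
  also have "\<dots> = L / m * (m * ?N)" using m by simp
  also have "\<dots> \<le> L / m * ?d"
    using d m L by (intro mult_left_mono) auto
  finally show "r \<le> L / m" using d by (simp add: r field_simps)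
qed

text \<open>Along an axis with \<open>u = 0\<close> the Hessian and its diagonal give the same
  value. This makes the set nonempty and places 1 between sigma and tau.\<close>

lemma one_in_curvature_ratios: "1 \<in> curvature_ratios f"
proof -
  \<comment> \<open>Any index will do; index types are nonempty.\<close>
  define i :: 'n where "i = undefined"
  have "axis i 1 \<bullet> (hessian f 0 *v axis i 1) = axis i 1 \<bullet> (diag (hessian f 0) *v axis i (1 :: real))"
    unfolding inner_axis_mult_axis by (simp add: diag_def)
  moreover have "axis i 1 \<bullet> (diag (hessian f 0) *v axis i 1) \<noteq> 0"
    using inner_hessian_diag_pos[of "axis i 1" 0] by (simp add: axis_eq_0_iff)
  ultimately show ?thesis
    unfolding curvature_ratios_def
    by (intro CollectI exI[of _ 0] exI[of _ "axis i 1"]) (auto simp: axis_eq_0_iff)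
qed

text \<open>Boundedness is what gives the real \<open>Inf\<close> and \<open>Sup\<close> their
  intended meaning.\<close>

lemma bdd_curvature_ratios:
  "bdd_below (curvature_ratios f)" "bdd_above (curvature_ratios f)"
  by (rule bdd_belowI, erule curvature_ratios_bounds(1))
    (rule bdd_aboveI, erule curvature_ratios_bounds(2))

lemma sigma_tau_bounds: "0 < sigma_const f" "sigma_const f \<le> 1" "1 \<le> tau_const f"
proof -
  have "m / L \<le> sigma_const f"
    unfolding sigma_const_def
    using one_in_curvature_ratios by (intro cInf_greatest curvature_ratios_bounds(1)) auto
  then show "0 < sigma_const f"
    using m curvature_ratios_bounds(3)[OF one_in_curvature_ratios]
    by (meson divide_pos_pos less_le_trans)
  show "sigma_const f \<le> 1" "1 \<le> tau_const f"
    unfolding sigma_const_def tau_const_def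
    by (rule cInf_lower[OF one_in_curvature_ratios bdd_curvature_ratios(1)]
        cSup_upper[OF one_in_curvature_ratios bdd_curvature_ratios(2)])+
qed

text \<open>The Taylor remainder divided by the diagonal form at \<open>x\<close> is itself a
  curvature ratio; \<open>v = 0\<close>, excluded from the ratios, is trivial.\<close>

lemma quadratic_bounds:
  shows "f x + grad f x \<bullet> v + sigma_const f / 2 * (v \<bullet> (diag (hessian f x) *v v)) \<le> f (x + v)"
    and "f (x + v) \<le> f x + grad f x \<bullet> v + tau_const f / 2 * (v \<bullet> (diag (hessian f x) *v v))"
proof -
  let ?d = "v \<bullet> (diag (hessian f x) *v v)"
  obtain u where u: "0 < u" "u < 1" and
    taylor: "f (x + v) = f x + grad f x \<bullet> v + (v \<bullet> (hessian f (x + u *\<^sub>R v) *v v)) / 2"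
    using taylor_hessian[OF C2] .
  let ?h = "v \<bullet> (hessian f (x + u *\<^sub>R v) *v v)"
  have "sigma_const f * ?d \<le> ?h \<and> ?h \<le> tau_const f * ?d"
  proof (cases "v = 0")
    case False
    then have "?h / ?d \<in> curvature_ratios f"
      using u by (force simp: curvature_ratios_def)
    then have "sigma_const f \<le> ?h / ?d" "?h / ?d \<le> tau_const f"
      unfolding sigma_const_def tau_const_def
      using bdd_curvature_ratios by (auto intro: cInf_lower cSup_upper)
    then show ?thesis
      using inner_hessian_diag_pos[OF False, of x] by (simp add: field_simps)
  qed simp
  then show
    "f x + grad f x \<bullet> v + sigma_const f / 2 * (v \<bullet> (diag (hessian f x) *v v)) \<le> f (x + v)"
    "f (x + v) \<le> f x + grad f x \<bullet> v + tau_const f / 2 * (v \<bullet> (diag (hessian f x) *v v))"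
    by (simp_all add: taylor)
qed

end

section \<open>Strongly convex extended-valued functions and their minimizers\<close>

definition estrongly_convex :: "real \<Rightarrow> ('a :: real_normed_vector \<Rightarrow> ereal) \<Rightarrow> bool" where
  "estrongly_convex m F \<longleftrightarrow>
     (\<forall>x y a b. \<forall>u\<in>{0<..<1}. F x = ereal a \<longrightarrow> F y = ereal b \<longrightarrow>
        F ((1 - u) *\<^sub>R x + u *\<^sub>R y)
          \<le> ereal ((1 - u) * a + u * b - m / 2 * (1 - u) * u * (norm (x - y))\<^sup>2))"

lemma estrongly_convexD:
  assumes "estrongly_convex m F" "F x = ereal a" "F y = ereal b" "0 < u" "u < 1"
  shows "F ((1 - u) *\<^sub>R x + u *\<^sub>R y)
    \<le> ereal ((1 - u) * a + u * b - m / 2 * (1 - u) * u * (norm (x - y))\<^sup>2)"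
  using assms by (simp add: estrongly_convex_def)

text \<open>A minimal value cannot be undercut on the segment from \<open>z\<close> to
  \<open>y\<close>. Dividing by \<open>u\<close> and letting \<open>u\<close> tend to 0 recovers the
  full constant \<open>m / 2\<close>. This gives both uniqueness and the lower bound on the
  objective gap.\<close>

lemma estrongly_convex_quadratic_growth:
  assumes sc: "estrongly_convex m F" and min: "is_arg_min F (\<lambda>_. True) z"
    and z: "F z = ereal a" and y: "F y = ereal b"
  shows "m / 2 * (norm (y - z))\<^sup>2 \<le> b - a"
proof -
  have "((\<lambda>u. m / 2 * (1 - u) * (norm (y - z))\<^sup>2) \<longlongrightarrow> m / 2 * (1 - 0) * (norm (y - z))\<^sup>2) (at_right 0)"
    by (intro tendsto_intros)
  moreover have "\<forall>\<^sub>F u in at_right 0. m / 2 * (1 - u) * (norm (y - z))\<^sup>2 \<le> b - a"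
  proof (rule eventually_at_rightI[of 0 1])
    fix u :: real assume u: "u \<in> {0<..<1}"
    have "ereal a \<le> F ((1 - u) *\<^sub>R z + u *\<^sub>R y)"
      using min z by (simp add: is_arg_min_linorder)
    also have "\<dots> \<le> ereal ((1 - u) * a + u * b - m / 2 * (1 - u) * u * (norm (z - y))\<^sup>2)"
      using u by (intro estrongly_convexD[OF sc z y]) auto
    finally have "u * (m / 2 * (1 - u) * (norm (y - z))\<^sup>2) \<le> u * (b - a)"
      by (simp add: algebra_simps norm_minus_commute)
    then show "m / 2 * (1 - u) * (norm (y - z))\<^sup>2 \<le> b - a"
      using u by (simp only: mult_le_cancel_left_pos greaterThanLessThan_iff)
  qed auto
  ultimately show ?thesis
    using tendsto_upperbound[of _ _ "at_right (0::real)"] by fastforce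
qed

text \<open>The midpoint of two near-minimizers has value at least the infimum, which forces them to
  be close. Completeness thus takes the place of compactness.\<close>

lemma estrongly_convex_ex_minimizer:
  fixes F :: "'a :: banach \<Rightarrow> ereal"
  assumes sc: "estrongly_convex m F" and m: "m > 0" and lsc: "lower_semicontinuous F"
    and lb: "\<And>y. ereal c \<le> F y" and fin: "F x0 < \<infinity>"
  shows "\<exists>z. is_arg_min F (\<lambda>_. True) z"
proof -
  have "ereal c \<le> (INF y. F y)"
    using lb by (auto intro: INF_greatest)
  moreover have "(INF y. F y) < \<infinity>"
    using fin by (meson INF_lower UNIV_I le_less_trans)
  ultimately obtain i where i: "(INF y. F y) = ereal i"
    by (cases "INF y. F y") auto
  have i_le: "ereal i \<le> F y" for y
    using i by (metis INF_lower UNIV_I)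
  have "\<exists>y v. F y = ereal v \<and> v < i + inverse (real (Suc n))" for n
  proof -
    have "(INF y. F y) < ereal (i + inverse (real (Suc n)))"
      using i by simp
    then obtain y where "F y < ereal (i + inverse (real (Suc n)))"
      by (auto simp: INF_less_iff)
    with lb[of y] show ?thesis by (cases "F y") auto
  qed
  then obtain X v where X: "\<And>n. F (X n) = ereal (v n)"
    and v: "\<And>n. v n < i + inverse (real (Suc n))"
    by metis
  \<comment> \<open>At the midpoint the convexity gain is \<open>m / 2 * 1/2 * 1/2 = m / 8\<close>
    times the squared distance, hence the factor \<open>8 / m\<close>.\<close>
  have close: "(norm (X p - X q))\<^sup>2 < 8 / m * inverse (real (Suc N))" if "N \<le> p" "N \<le> q" for p q N
  proof -
    have "ereal i \<le> F ((1 - 1/2) *\<^sub>R X p + (1/2) *\<^sub>R X q)"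
      by (rule i_le)
    also have "\<dots> \<le> ereal ((1 - 1/2) * v p + 1/2 * v q
        - m / 2 * (1 - 1/2) * (1/2) * (norm (X p - X q))\<^sup>2)"
      by (rule estrongly_convexD[OF sc X X]) auto
    finally have "m / 8 * (norm (X p - X q))\<^sup>2 \<le> (v p + v q) / 2 - i"
      by (simp add: field_simps)
    also have "\<dots> < inverse (real (Suc N))"
    proof -
      have "inverse (real (Suc p)) \<le> inverse (real (Suc N))"
        "inverse (real (Suc q)) \<le> inverse (real (Suc N))"
        using that by (auto intro!: le_imp_inverse_le)
      with v[of p] v[of q] have "v p < i + inverse (real (Suc N))" "v q < i + inverse (real (Suc N))"
        by (meson add_left_mono less_le_trans)+
      then show ?thesis by (simp add: field_simps del: of_nat_Suc)
    qed
    finally show ?thesis using m by (simp add: field_simps del: of_nat_Suc)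
  qed
  have "Cauchy X"
  proof (rule metric_CauchyI)
    fix e :: real assume e: "e > 0"
    then have "0 < m / 8 * e\<^sup>2" using m by simp
    then obtain N where N: "inverse (real (Suc N)) < m / 8 * e\<^sup>2"
      using reals_Archimedean by blast
    have "dist (X p) (X q) < e" if "N \<le> p" "N \<le> q" for p q
    proof -
      have "8 / m * inverse (real (Suc N)) < 8 / m * (m / 8 * e\<^sup>2)"
        using N m by (intro mult_strict_left_mono) auto
      then have "(norm (X p - X q))\<^sup>2 < e\<^sup>2"
        using close[OF that] m by simp
      then show ?thesis
        using e by (simp add: dist_norm power_less_imp_less_base)
    qed
    then show "\<exists>M. \<forall>p\<ge>M. \<forall>q\<ge>M. dist (X p) (X q) < e" by blast
  qed
  then obtain z where z: "X \<longlonglongrightarrow> z"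
    using Cauchy_convergent_iff convergent_def by blast
  have "F z \<le> ereal i"
  proof (rule ccontr)
    assume "\<not> F z \<le> ereal i"
    then obtain r where r: "ereal i < ereal r" "ereal r < F z"
      using ereal_dense2 by (metis not_le)
    then have "\<forall>\<^sub>F y in at z. ereal r < F y"
      using lsc unfolding lower_semicontinuous_def le_Liminf_iff by blast
    \<comment> \<open>Lower semicontinuity speaks of the punctured neighbourhood only. The bound
      \<open>r < F z\<close> adds the centre, which the sequence may hit.\<close>
    then have "\<forall>\<^sub>F y in nhds z. ereal r < F y"
      using r(2) by (auto simp: eventually_at_filter elim: eventually_mono)
    then have "\<forall>\<^sub>F n in sequentially. ereal r < F (X n)"
      using z by (rule eventually_compose_filterlim)
    moreover have "(\<lambda>n. i + inverse (real (Suc n))) \<longlonglongrightarrow> i + 0"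
      by (intro tendsto_intros LIMSEQ_inverse_real_of_nat)
    then have "\<forall>\<^sub>F n in sequentially. i + inverse (real (Suc n)) < r"
      using r(1) by (intro order_tendstoD(2)) auto
    ultimately have "\<forall>\<^sub>F n in sequentially. False"
      by eventually_elim (use X v in \<open>force dest: less_trans\<close>)
    then show False by simp
  qed
  then have "is_arg_min F (\<lambda>_. True) z"
    using i_le order_trans unfolding is_arg_min_linorder by blast
  then show ?thesis ..
qed

section \<open>Semicontinuity and strong convexity of the objective\<close>

lemma lower_semicontinuous_objective:
  assumes f: "\<And>x. isCont f x" and g: "lower_semicontinuous g" and proper: "proper g"
  shows "lower_semicontinuous (objective f g)"
  unfolding lower_semicontinuous_def le_Liminf_iff
proof (intro allI impI)
  fix x and c assume "c < objective f g x"
  then obtain r where r: "c < ereal r" "ereal r < objective f g x"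
    using ereal_dense2 by blast
  \<comment> \<open>The second real splits the slack: near \<open>x\<close>, \<open>g\<close> stays
    above \<open>s - f x\<close> while \<open>f\<close> drops by less than \<open>s - r\<close>, so
    the sum exceeds \<open>r\<close>.\<close>
  then obtain s where s: "ereal r < ereal s" "ereal s < objective f g x"
    using ereal_dense2 by blast
  have "ereal (s - f x) < g x"
    using s(2) by (cases "g x") (auto simp: objective_def)
  then have "\<forall>\<^sub>F y in at x. ereal (s - f x) < g y"
    using g unfolding lower_semicontinuous_def le_Liminf_iff by blast
  moreover have "\<forall>\<^sub>F y in at x. f x - (s - r) < f y"
    using f[of x] s(1) by (intro order_tendstoD(1)[of f "f x"]) (auto simp: isCont_def)
  ultimately show "\<forall>\<^sub>F y in at x. c < objective f g y"
  proof eventually_elim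
    case (elim y)
    then have "ereal r < objective f g y"
      using proper by (cases "g y") (auto simp: objective_def proper_def)
    with r(1) show ?case by simp
  qed
qed

text \<open>Only end points of finite objective value are considered, so \<open>g\<close> is finite
  there and its convexity becomes an inequality with a real right-hand side.\<close>

lemma estrongly_convex_objective:
  assumes f: "strongly_convex m f" and g: "econvex g"
  shows "estrongly_convex m (objective f g)"
  unfolding estrongly_convex_def
proof (intro allI ballI impI)
  fix x y a b and u :: real
  assume u: "u \<in> {0<..<1}" and x: "objective f g x = ereal a" and y: "objective f g y = ereal b"
  let ?z = "(1 - u) *\<^sub>R x + u *\<^sub>R y"
  have gx: "g x = ereal (a - f x)" and gy: "g y = ereal (b - f y)"
    using x y by (cases "g x"; cases "g y"; auto simp: objective_def)+
  have "g ?z \<le> ereal (1 - u) * g x + ereal u * g y"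
    using g u by (auto simp: econvex_def)
  also have "\<dots> = ereal ((1 - u) * (a - f x) + u * (b - f y))"
    by (simp add: gx gy)
  finally have "g ?z \<le> ereal ((1 - u) * (a - f x) + u * (b - f y))" .
  moreover have "f ?z \<le> (1 - u) * f x + u * f y - m / 2 * (1 - u) * u * (norm (x - y))\<^sup>2"
    using f u unfolding strongly_convex_def
    by (meson atLeastAtMost_iff greaterThanLessThan_iff less_imp_le)
  ultimately show "objective f g ?z
      \<le> ereal ((1 - u) * a + u * b - m / 2 * (1 - u) * u * (norm (x - y))\<^sup>2)"
    by (cases "g ?z") (auto simp: objective_def algebra_simps)
qed

section \<open>Scaled norms and the proximal map\<close>

lemma norm_mat_power2:
  assumes "positive_definite A"
  shows "(norm_mat A v)\<^sup>2 = v \<bullet> (A *v v)"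
proof -
  have "0 \<le> v \<bullet> (A *v v)"
    using assms by (cases "v = 0") (auto simp: positive_definite_def less_imp_le)
  then show ?thesis by (simp add: norm_mat_def)
qed

lemma scaleR_matrix_vector_mult: "(c *\<^sub>R A) *v v = c *\<^sub>R ((A :: real ^ 'n ^ 'm) *v v)"
  by (simp add: vec_eq_iff matrix_vector_mult_def sum_distrib_left mult.assoc)

lemma positive_definite_scaleR:
  assumes "positive_definite A" "c > 0"
  shows "positive_definite (c *\<^sub>R A)"
  using assms
  by (auto simp: positive_definite_def scaleR_matrix_vector_mult transpose_def vec_eq_iff)

text \<open>Positive definiteness excludes a kernel, so an inverse exists and the choice in
  \<open>matrix_inv\<close> picks one.\<close>

lemma positive_definite_matrix_inv:
  assumes "positive_definite A"
  shows "A *v (matrix_inv A *v v) = v"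
proof -
  have "x = 0" if "A *v x = 0" for x
    using assms that by (metis inner_zero_right less_irrefl positive_definite_def)
  then have "invertible A"
    by (metis invertible_left_inverse matrix_left_invertible_ker)
  then have "A ** matrix_inv A = mat 1"
    unfolding invertible_def matrix_inv_def by (rule someI2_ex) simp
  then show ?thesis
    by (simp add: matrix_vector_mul_assoc)
qed

text \<open>Completing the square turns the proximal objective into the quadratic model of the step,
  up to a constant.\<close>

lemma prox_gradient_step_minimizes_model:
  assumes A: "positive_definite A" and y: "y \<in> prox g A (x - matrix_inv A *v p)"
  shows "ereal (p \<bullet> (y - x) + 1 / 2 * (norm_mat A (y - x))\<^sup>2) + g y
    \<le> ereal (p \<bullet> (z - x) + 1 / 2 * (norm_mat A (z - x))\<^sup>2) + g z"
proof -
  define w where "w = matrix_inv A *v p"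
  have Aw: "A *v w = p"
    unfolding w_def by (rule positive_definite_matrix_inv[OF A])
  have wA: "w \<bullet> (A *v d) = p \<bullet> d" for d
    using A Aw by (metis dot_lmul_matrix positive_definite_def vector_transpose_matrix)
  \<comment> \<open>The cross term turns into the linear term because \<open>A\<close> is symmetric
    and \<open>A *v w = p\<close>; the remainder \<open>p \<bullet> w\<close> does not depend on
    \<open>v\<close> and cancels in the comparison.\<close>
  have square: "(norm_mat A (v - (x - w)))\<^sup>2
      = (norm_mat A (v - x))\<^sup>2 + 2 * (p \<bullet> (v - x)) + p \<bullet> w" for v
  proof -
    have "v - (x - w) = (v - x) + w" by simp
    moreover have "((v - x) + w) \<bullet> (A *v ((v - x) + w))
        = (v - x) \<bullet> (A *v (v - x)) + 2 * (p \<bullet> (v - x)) + p \<bullet> w"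
      unfolding matrix_vector_right_distrib inner_add_left inner_add_right wA Aw
      by (simp add: inner_commute)
    ultimately show ?thesis
      by (simp only: norm_mat_power2[OF A])
  qed
  have "g y + ereal (1 / 2 * (norm_mat A (y - (x - w)))\<^sup>2)
      \<le> g z + ereal (1 / 2 * (norm_mat A (z - (x - w)))\<^sup>2)"
    using y by (simp add: prox_def is_arg_min_linorder w_def)
  then show ?thesis
    unfolding square by (cases "g y"; cases "g z") (auto simp: field_simps)
qed

section \<open>One iteration of the method\<close>

context
  fixes f :: "real ^ 'n \<Rightarrow> real" and g :: "real ^ 'n \<Rightarrow> ereal" and m L \<eta> \<beta> :: real
  assumes C2: "twice_continuously_differentiable f"
    and sc: "strongly_convex m f" and m: "m > 0"
    and lip: "L-lipschitz_on UNIV (grad f)"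
    and \<eta>: "\<eta> > 1" and \<beta>: "0 < \<beta>" "\<beta> \<le> 1"
begin

lemma pdnm_step_model_bound:
  assumes "pdnm_step f g \<eta> \<beta> x x'"
  shows "objective f g x' \<le> ereal (f x + grad f x \<bullet> v
      + max 1 (\<eta> / \<beta> * tau_const f) / 2 * (v \<bullet> (diag (hessian f x) *v v))) + g (x + v)"
proof -
  define D where "D = diag (hessian f x)"
  define q where "q = (\<lambda>v. v \<bullet> (D *v v))"
  obtain y k where D: "positive_definite D"
    and y: "\<And>j. j \<le> k \<Longrightarrow> y j \<in> prox g (\<eta> ^ j *\<^sub>R D) (x - matrix_inv (\<eta> ^ j *\<^sub>R D) *v grad f x)"
    and rej: "\<And>j. j < k \<Longrightarrow> \<not> sufficient_decrease f \<beta> (\<eta> ^ j *\<^sub>R D) x (y j)"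
    and acc: "sufficient_decrease f \<beta> (\<eta> ^ k *\<^sub>R D) x (y k)"
    and x': "x' = y k"
    using assms unfolding pdnm_step_def D_def Let_def by blast
  have pos: "positive_definite (\<eta> ^ j *\<^sub>R D)" for j
    using \<eta> by (intro positive_definite_scaleR[OF D]) auto
  have norm2: "(norm_mat (\<eta> ^ j *\<^sub>R D) w)\<^sup>2 = \<eta> ^ j * q w" for j w
    by (simp add: norm_mat_power2[OF pos] scaleR_matrix_vector_mult q_def)
  have q_nonneg: "0 \<le> q w" for w
    using D by (cases "w = 0") (auto simp: positive_definite_def q_def less_imp_le)
  \<comment> \<open>The 1 in the maximum covers acceptance at \<open>k = 0\<close>. Otherwise the
    last rejected index is \<open>k - 1\<close>, and one more factor \<open>\<eta>\<close> accounts
    for the step to \<open>k\<close>.\<close>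
  have scale: "\<eta> ^ k \<le> max 1 (\<eta> / \<beta> * tau_const f)"
  proof (cases k)
    case (Suc j)
    let ?d = "y j - x"
    have "f x + grad f x \<bullet> ?d + \<beta> / 2 * (\<eta> ^ j * q ?d) < f (x + ?d)"
      using rej[of j] Suc by (simp add: sufficient_decrease_def norm2)
    also have "\<dots> \<le> f x + grad f x \<bullet> ?d + tau_const f / 2 * q ?d"
      unfolding q_def D_def by (rule quadratic_bounds(2)[OF C2 sc m lip])
    finally have "(\<beta> * \<eta> ^ j) * q ?d < tau_const f * q ?d" by simp
    \<comment> \<open>The strict inequality rules out \<open>q ?d = 0\<close>, so the factor
      cancels.\<close>
    then have "\<beta> * \<eta> ^ j < tau_const f"
      using q_nonneg mult_less_cancel_right_disj by (metis not_le)
    then have "\<eta> / \<beta> * (\<beta> * \<eta> ^ j) < \<eta> / \<beta> * tau_const f"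
      using \<eta> \<beta> by (intro mult_strict_left_mono) auto
    then show ?thesis using Suc \<beta> by simp
  qed simp
  have "f (y k) \<le> f x + (grad f x \<bullet> (y k - x) + \<beta> * (1 / 2 * (\<eta> ^ k * q (y k - x))))"
    using acc by (simp add: sufficient_decrease_def norm2)
  \<comment> \<open>Here \<open>\<beta> \<le> 1\<close> is used: the acceptance bound is raised to
    the model that the proximal point minimizes.\<close>
  also have "\<beta> * (1 / 2 * (\<eta> ^ k * q (y k - x))) \<le> 1 / 2 * (\<eta> ^ k * q (y k - x))"
    using \<beta> \<eta> q_nonneg by (intro mult_left_le_one_le) auto
  finally have "objective f g x'
      \<le> ereal (f x) + (ereal (grad f x \<bullet> (y k - x) + 1 / 2 * (\<eta> ^ k * q (y k - x))) + g (y k))"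
    unfolding x' by (cases "g (y k)") (auto simp: objective_def)
  also have "\<dots> \<le> ereal (f x) + (ereal (grad f x \<bullet> v + 1 / 2 * (\<eta> ^ k * q v)) + g (x + v))"
    using prox_gradient_step_minimizes_model[OF pos y[OF order_refl], of "x + v"]
    by (intro add_left_mono) (simp add: norm2)
  also have "\<dots> \<le> ereal (f x + grad f x \<bullet> v + max 1 (\<eta> / \<beta> * tau_const f) / 2 * q v) + g (x + v)"
    using mult_right_mono[OF scale q_nonneg[of v]] by (cases "g (x + v)") auto
  finally show ?thesis by (simp add: q_def D_def)
qed

lemma pdnm_step_contraction:
  assumes step: "pdnm_step f g \<eta> \<beta> x x'" and g: "econvex g"
    and x: "objective f g x = ereal a" and z: "objective f g z = ereal b"
    and \<alpha>: "\<alpha> = sigma_const f / max 1 (\<eta> / \<beta> * tau_const f)"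
  shows "objective f g x' \<le> ereal ((1 - \<alpha>) * a + \<alpha> * b)"
proof -
  define M where "M = max 1 (\<eta> / \<beta> * tau_const f)"
  note \<sigma>\<tau> = sigma_tau_bounds[OF C2 sc m lip]
  define v where "v = z - x"
  define d where "d = v \<bullet> (diag (hessian f x) *v v)"
  have gx: "g x = ereal (a - f x)" and gz: "g z = ereal (b - f z)"
    using x z by (cases "g x"; cases "g z"; auto simp: objective_def)+
  \<comment> \<open>Strictness gives \<open>M > 1\<close> and so \<open>\<alpha> < 1\<close>, as
    \<open>econvex\<close> speaks of the open interval only.\<close>
  have "1 < \<eta> / \<beta>" using \<eta> \<beta> by simp
  moreover have "\<eta> / \<beta> \<le> \<eta> / \<beta> * tau_const f"
    using \<eta> \<beta> \<sigma>\<tau> by (simp add: field_simps)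
  ultimately have M: "1 < M" unfolding M_def by linarith
  have \<alpha>': "0 < \<alpha>" "\<alpha> < 1" and \<alpha>M: "\<alpha> * M = sigma_const f"
    using \<sigma>\<tau> M unfolding \<alpha> M_def[symmetric] by auto
  have "(1 - \<alpha>) *\<^sub>R x + \<alpha> *\<^sub>R z = x + \<alpha> *\<^sub>R v"
    by (simp add: v_def algebra_simps)
  moreover have "g ((1 - \<alpha>) *\<^sub>R x + \<alpha> *\<^sub>R z) \<le> ereal (1 - \<alpha>) * g x + ereal \<alpha> * g z"
    using g \<alpha>' by (auto simp: econvex_def)
  ultimately have g_le: "g (x + \<alpha> *\<^sub>R v) \<le> ereal ((1 - \<alpha>) * (a - f x) + \<alpha> * (b - f z))"
    by (simp add: gx gz)
  have "f x + grad f x \<bullet> v + sigma_const f / 2 * d \<le> f z"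
    using quadratic_bounds(1)[OF C2 sc m lip, of x v] by (simp add: v_def d_def)
  then have "\<alpha> * (f x + grad f x \<bullet> v + sigma_const f / 2 * d) \<le> \<alpha> * f z"
    using \<alpha>' by (intro mult_left_mono) auto
  \<comment> \<open>This is where \<open>\<alpha> = sigma_const f / M\<close> comes from: one factor
    \<open>\<alpha>\<close> of the quadratic term absorbs \<open>M\<close> and leaves sigma.\<close>
  moreover have "M / 2 * (\<alpha> * (\<alpha> * d)) = \<alpha> * (sigma_const f / 2 * d)"
    unfolding \<alpha>M[symmetric] by simp
  ultimately have f_le: "f x + grad f x \<bullet> (\<alpha> *\<^sub>R v) + M / 2 * (\<alpha> * (\<alpha> * d))
      \<le> (1 - \<alpha>) * f x + \<alpha> * f z"
    by (simp only: inner_scaleR_right) (simp add: algebra_simps)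
  have "objective f g x' \<le> ereal (f x + grad f x \<bullet> (\<alpha> *\<^sub>R v) + M / 2 * (\<alpha> * (\<alpha> * d))) + g (x + \<alpha> *\<^sub>R v)"
    using pdnm_step_model_bound[OF step, of "\<alpha> *\<^sub>R v"]
    by (simp add: M_def d_def matrix_vector_mult_scaleR)
  also have "\<dots> \<le> ereal ((1 - \<alpha>) * f x + \<alpha> * f z) + ereal ((1 - \<alpha>) * (a - f x) + \<alpha> * (b - f z))"
    using f_le g_le by (intro add_mono) auto
  also have "\<dots> = ereal ((1 - \<alpha>) * a + \<alpha> * b)"
    by (simp add: algebra_simps)
  finally show ?thesis .
qed

end

section \<open>The unique minimizer and the linear rate\<close>

theorem theorem2p4:
  fixes f :: "real ^ 'n \<Rightarrow> real" and g :: "real ^ 'n \<Rightarrow> ereal"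
    and x :: "nat \<Rightarrow> real ^ 'n" and m L1 \<eta> \<beta> :: real
  assumes "twice_continuously_differentiable f"
    and "proper g" and "lower_semicontinuous g" and "directionally_differentiable g"
    and "\<exists>c :: real. \<forall>y. ereal c \<le> objective f g y"
    and "\<eta> > 1" and "0 < \<beta>" and "\<beta> \<le> 1"
    and "pdnm_sequence f g \<eta> \<beta> x"
    and "m > 0" and "strongly_convex m f"
    and "L1-lipschitz_on UNIV (grad f)"
    and "econvex g"
  defines "\<eta>bar \<equiv> max (1 / tau_const f) (\<eta> / \<beta>)"
  shows "(\<exists>!xstar. is_arg_min (objective f g) (\<lambda>_. True) xstar) \<and>
    \<eta>bar \<ge> 1 \<and>
    (\<forall>xstar. is_arg_min (objective f g) (\<lambda>_. True) xstar \<longrightarrow>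
      (\<forall>t. ereal (m / 2 * (norm (x t - xstar))\<^sup>2)
             \<le> objective f g (x t) - objective f g xstar \<and>
           objective f g (x t) - objective f g xstar
             \<le> ereal ((1 - sigma_const f / (\<eta>bar * tau_const f)) ^ t)
                 * (objective f g (x 0) - objective f g xstar)))"
proof -
  note C2 = assms(1) and m = \<open>m > 0\<close> and sc = \<open>strongly_convex m f\<close>
    and lip = \<open>L1-lipschitz_on UNIV (grad f)\<close>
  let ?F = "objective f g"
  let ?\<tau> = "tau_const f"
  obtain c where c: "\<And>y. ereal c \<le> ?F y" using assms(5) by blast
  have x0: "?F (x 0) < \<infinity>" and step: "\<And>t. pdnm_step f g \<eta> \<beta> (x t) (x (Suc t))"
    using \<open>pdnm_sequence f g \<eta> \<beta> x\<close>
    by (auto simp: pdnm_sequence_def edom_def objective_def)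
  have scF: "estrongly_convex m ?F"
    by (rule estrongly_convex_objective[OF sc \<open>econvex g\<close>])
  have "isCont f y" for y
    using C2 by (simp add: twice_continuously_differentiable_def differentiable_imp_continuous_within)
  then have lsc: "lower_semicontinuous ?F"
    by (intro lower_semicontinuous_objective \<open>proper g\<close> \<open>lower_semicontinuous g\<close>)
  \<comment> \<open>The start lies in the domain and the objective is bounded below, so its
    differences can be treated as real numbers.\<close>
  have min_finite: "\<exists>a. ?F z = ereal a" if "is_arg_min ?F (\<lambda>_. True) z" for z
  proof -
    have "?F z \<le> ?F (x 0)" using that by (simp add: is_arg_min_linorder)
    then show ?thesis using x0 c[of z] by (cases "?F z") auto
  qed
  have "\<exists>!z. is_arg_min ?F (\<lambda>_. True) z"
  proof (rule ex_ex1I)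
    show "\<exists>z. is_arg_min ?F (\<lambda>_. True) z"
      by (rule estrongly_convex_ex_minimizer[OF scF m lsc c x0])
    fix y z assume yz: "is_arg_min ?F (\<lambda>_. True) y" "is_arg_min ?F (\<lambda>_. True) z"
    obtain a where a: "?F z = ereal a" using min_finite[OF yz(2)] by blast
    have "?F y = ereal a"
      using yz a by (metis is_arg_min_linorder order_antisym)
    from estrongly_convex_quadratic_growth[OF scF yz(2) a this]
    show "y = z" using m by (simp add: mult_le_0_iff)
  qed
  moreover
  have \<tau>: "1 \<le> ?\<tau>" and \<sigma>: "0 < sigma_const f" "sigma_const f \<le> 1"
    using sigma_tau_bounds[OF C2 sc m lip] by auto
  have "1 \<le> \<eta> / \<beta>" using assms by simp
  then have \<eta>bar: "1 \<le> \<eta>bar" by (simp add: \<eta>bar_def)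
  moreover
  define \<alpha> where "\<alpha> = sigma_const f / (\<eta>bar * ?\<tau>)"
  \<comment> \<open>Multiplying the maximum by the positive tau turns the rate of the statement into
    the one of the single step.\<close>
  have \<eta>bar_\<tau>: "\<eta>bar * ?\<tau> = max 1 (\<eta> / \<beta> * ?\<tau>)"
    using \<tau> by (simp add: \<eta>bar_def max_mult_distrib_right)
  have "ereal (m / 2 * (norm (x t - z))\<^sup>2) \<le> ?F (x t) - ?F z \<and>
      ?F (x t) - ?F z \<le> ereal ((1 - \<alpha>) ^ t) * (?F (x 0) - ?F z)"
    if z: "is_arg_min ?F (\<lambda>_. True) z" for z t
  proof -
    obtain b where b: "?F z = ereal b" using min_finite[OF z] by blast
    obtain a0 where a0: "?F (x 0) = ereal a0"
      using x0 c[of "x 0"] by (cases "?F (x 0)") auto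
    have "1 * 1 \<le> \<eta>bar * ?\<tau>" using \<eta>bar \<tau> by (intro mult_mono) auto
    then have \<alpha>1: "\<alpha> \<le> 1" using \<sigma> by (simp add: \<alpha>_def)
    \<comment> \<open>Finiteness is carried through the induction because the contraction needs a
      real value at the current iterate.\<close>
    have "\<exists>a. ?F (x t) = ereal a \<and> a - b \<le> (1 - \<alpha>) ^ t * (a0 - b)"
    proof (induction t)
      case 0
      show ?case using a0 by simp
    next
      case (Suc t)
      then obtain a where a: "?F (x t) = ereal a" "a - b \<le> (1 - \<alpha>) ^ t * (a0 - b)" by blast
      have le: "?F (x (Suc t)) \<le> ereal ((1 - \<alpha>) * a + \<alpha> * b)"
        using pdnm_step_contraction[OF C2 sc m lip assms(6-8) step \<open>econvex g\<close> a(1) b]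
        by (simp add: \<alpha>_def \<eta>bar_\<tau>)
      then obtain a' where a': "?F (x (Suc t)) = ereal a'"
        using c[of "x (Suc t)"] by (cases "?F (x (Suc t))") auto
      have "a' - b \<le> (1 - \<alpha>) * (a - b)"
        using le a' by (simp add: algebra_simps)
      \<comment> \<open>The factor \<open>1 - \<alpha>\<close> is nonnegative, so the induction
        hypothesis may be multiplied by it.\<close>
      also have "\<dots> \<le> (1 - \<alpha>) * ((1 - \<alpha>) ^ t * (a0 - b))"
        using a(2) \<alpha>1 by (intro mult_left_mono) auto
      finally show ?case using a' by simp
    qed
    then obtain a where a: "?F (x t) = ereal a" "a - b \<le> (1 - \<alpha>) ^ t * (a0 - b)" by blast
    with estrongly_convex_quadratic_growth[OF scF z b a(1)] show ?thesis
      by (simp add: b a0)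
  qed
  ultimately show ?thesis unfolding \<alpha>_def by blast
qed

end
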